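(* Let $M$ be a differentiable manifold, $\gamma:J\to M$ a path ($J\subset\mathbb R$ an interval), and $D$ an $S$-derivation on $M$. (i) If there is a local basis, holonomic on $\gamma(J)$, in which the components of $D_X$ vanish on $\gamma(J)$ for every vector field $X$, then $D$ is torsion free on $\gamma(J)$. (ii) Conversely, if $D$ is torsion free on $\gamma(J)$ and there exists a continuous basis along $\gamma$ in which the components of $D_X$ vanish on $\gamma(J)$ for every vector field $X$, then all bases with this property are holonomic along $\gamma$ (on $\gamma(J)$).
   Context: $S$ is a fixed map assigning to each $C^1$ vector field $X$ on $M$ a tensor field $S_X$ of type $(1,1)$ (no linearity in $X$ is assumed), regarded as a derivation of the tensor algebra. The $S$-derivation along $X$ is $D_X=L_X+S_X$, with $L_X$ the Lie derivative; the map $D:X\mapsto D_X$ is called an $S$-derivation. In a local basis $\{E_i\}$ the components $(W_X)^i_{\ j}$ of $D_X$ are defined by $D_X(E_j)=(W_X)^i_{\ j}E_i$ (summation convention). The torsion operator of $D$ is $T^D(X,Y)=D_XY-D_YX-[X,Y]$ for vector fields $X,Y$; $D$ is torsion free on $\gamma(J)$ if $T^D(X,Y)|_{\gamma(s)}=0$ for all $C^1$ vector fields $X,Y$ and all $s\in J$. Bases are bases of vector fields defined in a neighborhood of $\gamma(J)$; "continuous" means a genuine, unglued basis on such a neighborhood, as opposed to one pieced together discontinuously from local bases, and the bases are taken to be $C^1$ so that the components and commutators make sense. A basis $\{E_i\}$ is holonomic on (along) $\gamma(J)$ if $[E_i,E_j]|_{\gamma(s)}=0$ for all $i,j$ and all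 $s\in J$. *)

theory Defs
  imports "HOL-Analysis.Analysis" "HOL-Library.Function_Algebras"
begin

instantiation "fun" :: (type, real_vector) real_vector
begin

definition scaleR_fun_def: "scaleR r f = (\<lambda>x. r *\<^sub>R f x)"

instance
  by standard (simp_all add: scaleR_fun_def plus_fun_def fun_eq_iff scaleR_add_right scaleR_add_left)

end

definition C1_on :: "'a::real_normed_vector set \<Rightarrow> ('a \<Rightarrow> 'b::real_normed_vector) \<Rightarrow> bool" where
  "C1_on S f \<longleftrightarrow> (\<exists>f'. (\<forall>x\<in>S. (f has_derivative blinfun_apply (f' x)) (at x)) \<and> continuous_on S f')"

definition C2_on :: "'a::real_normed_vector set \<Rightarrow> ('a \<Rightarrow> 'b::real_normed_vector) \<Rightarrow> bool" where
  "C2_on S f \<longleftrightarrow> (\<exists>f'. (\<forall>x\<in>S. (f has_derivative blinfun_apply (f' x)) (at x)) \<and> C1_on S f')"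

text \<open>A chart is a pair of its domain and its coordinate map, the values of the latter outside
  the domain being irrelevant.\<close>

type_synonym ('m, 'n) chart = "'m set \<times> ('m \<Rightarrow> real ^ 'n)"

definition chart_inv :: "('m, 'n) chart \<Rightarrow> real ^ 'n \<Rightarrow> 'm" where
  "chart_inv c = inv_into (fst c) (snd c)"

definition transition :: "('m, 'n) chart \<Rightarrow> ('m, 'n) chart \<Rightarrow> real ^ 'n \<Rightarrow> real ^ 'n" where
  "transition c d = snd d \<circ> chart_inv c"

definition charts_at :: "('m, 'n) chart set \<Rightarrow> 'm \<Rightarrow> ('m, 'n) chart set" where
  "charts_at A p = {c \<in> A. p \<in> fst c}"

text \<open>Class \<open>C\<^sup>2\<close> is the least regularity for which \<open>C\<^sup>1\<close> vector fields make sense; the atlas need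
  not be maximal, so every smooth atlas is admitted as it stands.\<close>

definition differentiable_manifold :: "'m topology \<Rightarrow> ('m, 'n::finite) chart set \<Rightarrow> bool" where
  "differentiable_manifold M A \<longleftrightarrow>
     Hausdorff_space M \<and>
     (\<forall>c\<in>A. openin M (fst c) \<and> open (snd c ` fst c) \<and>
        homeomorphic_map (subtopology M (fst c)) (top_of_set (snd c ` fst c)) (snd c)) \<and>
     topspace M = (\<Union>c\<in>A. fst c) \<and>
     (\<forall>c\<in>A. \<forall>d\<in>A. C2_on (snd c ` (fst c \<inter> fst d)) (transition c d))"

text \<open>A tangent vector at \<open>p\<close> is the family of its component vectors in all charts around \<open>p\<close>
  (extended by zero to the other charts), subject to the contravariant transformation law.\<close>

type_synonym ('m, 'n) tangent_vector = "('m, 'n) chart \<Rightarrow> real ^ 'n"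

definition tangent_space ::
    "('m, 'n::finite) chart set \<Rightarrow> 'm \<Rightarrow> ('m, 'n) tangent_vector set" where
  "tangent_space A p =
     {v. (\<forall>c\<in>charts_at A p. \<forall>d\<in>charts_at A p.
            v d = frechet_derivative (transition c d) (at (snd c p)) (v c)) \<and>
         (\<forall>c. c \<notin> charts_at A p \<longrightarrow> v c = 0)}"

type_synonym ('m, 'n) vector_field = "'m \<Rightarrow> ('m, 'n) tangent_vector"

definition local_rep :: "('m, 'n) vector_field \<Rightarrow> ('m, 'n) chart \<Rightarrow> real ^ 'n \<Rightarrow> real ^ 'n" where
  "local_rep X c x = X (chart_inv c x) c"

text \<open>Vector fields are extensional functions, so that a map defined on \<open>C1_vector_fields A U\<close> is
  a map of the fields on \<open>U\<close> and not of their values elsewhere.\<close>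

definition C1_vector_fields ::
    "('m, 'n::finite) chart set \<Rightarrow> 'm set \<Rightarrow> ('m, 'n) vector_field set" where
  "C1_vector_fields A U =
     {X \<in> Pi\<^sub>E U (tangent_space A). \<forall>c\<in>A. C1_on (snd c ` (fst c \<inter> U)) (local_rep X c)}"

text \<open>In a chart, \<open>[X, Y]\<^sup>i = X\<^sup>j \<partial>\<^sub>j Y\<^sup>i - Y\<^sup>j \<partial>\<^sub>j X\<^sup>i\<close>.\<close>

definition lie_bracket ::
    "('m, 'n::finite) chart set \<Rightarrow> ('m, 'n) vector_field \<Rightarrow> ('m, 'n) vector_field \<Rightarrow> ('m, 'n) vector_field"
  where
  "lie_bracket A X Y p = (\<lambda>c.
     if c \<in> charts_at A p
     then frechet_derivative (local_rep Y c) (at (snd c p)) (X p c)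
        - frechet_derivative (local_rep X c) (at (snd c p)) (Y p c)
     else 0)"

text \<open>On vector fields, \<open>L\<^sub>X Y = [X, Y]\<close>.\<close>

abbreviation lie_derivative ::
    "('m, 'n::finite) chart set \<Rightarrow> ('m, 'n) vector_field \<Rightarrow> ('m, 'n) vector_field \<Rightarrow> ('m, 'n) vector_field"
  where
  "lie_derivative A X Y \<equiv> lie_bracket A X Y"

text \<open>No regularity in the base point is demanded of a tensor field of type (1,1).\<close>

definition tensor_field_11 ::
    "'m topology \<Rightarrow> ('m, 'n::finite) chart set
      \<Rightarrow> ('m \<Rightarrow> ('m, 'n) tangent_vector \<Rightarrow> ('m, 'n) tangent_vector) \<Rightarrow> bool" where
  "tensor_field_11 M A T \<longleftrightarrow>
     (\<forall>p\<in>topspace M.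
        T p \<in> tangent_space A p \<rightarrow> tangent_space A p \<and>
        (\<forall>u\<in>tangent_space A p. \<forall>v\<in>tangent_space A p. T p (u + v) = T p u + T p v) \<and>
        (\<forall>r. \<forall>v\<in>tangent_space A p. T p (r *\<^sub>R v) = r *\<^sub>R T p v))"

type_synonym ('m, 'n) S_map =
  "('m, 'n) vector_field \<Rightarrow> 'm \<Rightarrow> ('m, 'n) tangent_vector \<Rightarrow> ('m, 'n) tangent_vector"

definition is_S_map :: "'m topology \<Rightarrow> ('m, 'n::finite) chart set \<Rightarrow> ('m, 'n) S_map \<Rightarrow> bool" where
  "is_S_map M A S \<longleftrightarrow> (\<forall>X\<in>C1_vector_fields A (topspace M). tensor_field_11 M A (S X))"

text \<open>The action of \<open>D\<^sub>X = L\<^sub>X + S\<^sub>X\<close> on vector fields; \<open>X\<close> is a global field, whereas \<open>Y\<close> may be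
  defined on an open subset only.\<close>

definition S_derivation ::
    "('m, 'n::finite) chart set \<Rightarrow> ('m, 'n) S_map
      \<Rightarrow> ('m, 'n) vector_field \<Rightarrow> ('m, 'n) vector_field \<Rightarrow> ('m, 'n) vector_field" where
  "S_derivation A S X Y p = lie_derivative A X Y p + S X p (Y p)"

definition torsion ::
    "('m, 'n::finite) chart set \<Rightarrow> ('m, 'n) S_map
      \<Rightarrow> ('m, 'n) vector_field \<Rightarrow> ('m, 'n) vector_field \<Rightarrow> ('m, 'n) vector_field" where
  "torsion A S X Y p =
     S_derivation A S X Y p - S_derivation A S Y X p - lie_bracket A X Y p"

definition torsion_free_on ::
    "'m topology \<Rightarrow> ('m, 'n::finite) chart set \<Rightarrow> ('m, 'n) S_map \<Rightarrow> 'm set \<Rightarrow> bool" where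
  "torsion_free_on M A S Q \<longleftrightarrow>
     (\<forall>X\<in>C1_vector_fields A (topspace M). \<forall>Y\<in>C1_vector_fields A (topspace M).
        \<forall>p\<in>Q. torsion A S X Y p = 0)"

definition basis_near ::
    "'m topology \<Rightarrow> ('m, 'n::finite) chart set \<Rightarrow> 'm set \<Rightarrow> ('n \<Rightarrow> ('m, 'n) vector_field) \<Rightarrow> bool"
  where
  "basis_near M A Q E \<longleftrightarrow>
     (\<exists>U. openin M U \<and> Q \<subseteq> U \<and>
        (\<forall>i. E i \<in> C1_vector_fields A U) \<and>
        (\<forall>p\<in>U. inj (\<lambda>i. E i p) \<and> independent (range (\<lambda>i. E i p)) \<and>
           span (range (\<lambda>i. E i p)) = tangent_space A p))"

definition holonomic_on ::
    "('m, 'n::finite) chart set \<Rightarrow> 'm set \<Rightarrow> ('n \<Rightarrow> ('m, 'n) vector_field) \<Rightarrow> bool" where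
  "holonomic_on A Q E \<longleftrightarrow> (\<forall>i j. \<forall>p\<in>Q. lie_bracket A (E i) (E j) p = 0)"

text \<open>\<open>components A S E X i j p\<close> is \<open>(W\<^sub>X)\<^sup>i\<^sub>j\<close> at \<open>p\<close>, that is, the coefficient of \<open>E\<^sub>i\<close> in
  \<open>D\<^sub>X E\<^sub>j\<close>.\<close>

definition components ::
    "('m, 'n::finite) chart set \<Rightarrow> ('m, 'n) S_map \<Rightarrow> ('n \<Rightarrow> ('m, 'n) vector_field)
      \<Rightarrow> ('m, 'n) vector_field \<Rightarrow> 'n \<Rightarrow> 'n \<Rightarrow> 'm \<Rightarrow> real" where
  "components A S E X i j p =
     representation (range (\<lambda>k. E k p)) (S_derivation A S X (E j) p) (E i p)"

definition components_vanish_on ::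
    "'m topology \<Rightarrow> ('m, 'n::finite) chart set \<Rightarrow> ('m, 'n) S_map \<Rightarrow> 'm set
      \<Rightarrow> ('n \<Rightarrow> ('m, 'n) vector_field) \<Rightarrow> bool" where
  "components_vanish_on M A S Q E \<longleftrightarrow>
     (\<forall>X\<in>C1_vector_fields A (topspace M). \<forall>i j. \<forall>p\<in>Q. components A S E X i j p = 0)"

end

theory Submission
  imports Defs
begin

text \<open>
  Let \<open>E\<close> be a frame around \<open>\<gamma>(J)\<close> in which all components vanish on \<open>\<gamma>(J)\<close>, that is,
  \<open>D\<^sub>X E\<^sub>j = 0\<close> there. Since \<open>D\<^sub>X = L\<^sub>X + S\<^sub>X\<close>, the tensor \<open>S\<^sub>X\<close> is then known on the frame,
  \<open>S\<^sub>X E\<^sub>j = - [X, E\<^sub>j]\<close>, and hence on every vector, because \<open>S\<^sub>X\<close> acts linearly at each point.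
  At a point where \<open>X = \<Sum> a\<^sub>i E\<^sub>i\<close> and \<open>Y = \<Sum> b\<^sub>j E\<^sub>j\<close>, this turns
  \<open>T(X, Y) = S\<^sub>X Y - S\<^sub>Y X + [X, Y]\<close> into
  \<open>T(X, Y) = - \<Sum> b\<^sub>j [X, E\<^sub>j] + \<Sum> a\<^sub>i [Y, E\<^sub>i] + [X, Y]\<close>. In a chart, the derivatives of \<open>X\<close> and
  \<open>Y\<close> cancel and what is left is \<open>T(X, Y) = - \<Sum> a\<^sub>i b\<^sub>j [E\<^sub>i, E\<^sub>j]\<close> (\<open>torsion_frame\<close>). So a
  holonomic frame forces the torsion to vanish. Conversely, vanishing torsion gives
  \<open>[E\<^sub>k, E\<^sub>l] = 0\<close> at \<open>p\<close>, once there are global fields \<open>X\<close> and \<open>Y\<close> with the values \<open>E\<^sub>k\<close> and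
  \<open>E\<^sub>l\<close> at \<open>p\<close>.

  Two facts carry the analytic weight. First, \<open>representation\<close> is zero by convention outside the
  span, so vanishing components only say that \<open>D\<^sub>X E\<^sub>j\<close> vanishes once it is known to be a tangent
  vector. Hence the bracket has to obey the transformation law between charts
  (\<open>lie_bracket_tangent\<close>), which comes down to the symmetry of second derivatives of the transition
  maps (\<open>second_derivative_symmetric\<close>). Second, torsion freeness only concerns globally defined
  fields, whereas the frame lives near \<open>\<gamma>(J)\<close>. A \<open>C\<^sup>1\<close> bump function in a chart yields a global
  field with any prescribed value at a point (\<open>tangent_vector_extends\<close>); the Hausdorff property
  makes its extension by zero \<open>C\<^sup>1\<close>.
\<close>

section \<open>Calculus in normed spaces\<close>

text \<open>The second difference of \<open>f\<close> over the parallelogram spanned by \<open>y\<close> and \<open>z\<close> is the increment,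
  along \<open>y\<close>, of \<open>u \<mapsto> f (x + u + z) - f (x + u)\<close>. The derivative of this map is \<open>D z\<close> up to the two
  remainders in the first-order expansion of \<open>f'\<close> at \<open>x\<close>, which leaves an error estimated by the
  mean value inequality.\<close>

lemma norm_second_difference_le:
  fixes f :: "'a::real_normed_vector \<Rightarrow> 'b::real_normed_vector" and f' :: "'a \<Rightarrow> 'a \<Rightarrow>\<^sub>L 'b"
    and D :: "'a \<Rightarrow> 'a \<Rightarrow>\<^sub>L 'b"
  assumes f': "\<And>w. norm w < d \<Longrightarrow> (f has_derivative blinfun_apply (f' (x + w))) (at (x + w))"
    and D: "linear D"
    and R: "\<And>w. norm w < d \<Longrightarrow> norm (f' (x + w) - f' x - D w) \<le> e * norm w"
    and e: "0 \<le> e" and small: "norm y + norm z < d"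
  shows "norm (f (x + y + z) - f (x + y) - f (x + z) + f x - D z y)
           \<le> 2 * e * (norm y + norm z) * norm y"
proof -
  define G where "G u = f (x + (u + z)) - f (x + u) - D z u" for u :: 'a
  define G' where "G' u = f' (x + (u + z)) - f' (x + u) - D z" for u :: 'a
  have lt: "norm u < d" "norm (u + z) < d" if "u \<in> cball 0 (norm y)" for u :: 'a
    using that small norm_triangle_ineq[of u z] norm_ge_zero[of z] by (auto simp: dist_norm simp del: norm_ge_zero)
  have "norm (G y - G 0) \<le> (2 * e * (norm y + norm z)) * norm (y - 0)"
  proof (rule differentiable_bound[where S = "cball 0 (norm y)" and f' = "\<lambda>u. blinfun_apply (G' u)"])
    fix u :: 'a assume u: "u \<in> cball 0 (norm y)"
    have "((\<lambda>u. x + (u + z)) has_derivative (\<lambda>h. h)) (at u)"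
      by (auto intro!: derivative_eq_intros)
    then have "((\<lambda>u. f (x + (u + z))) has_derivative blinfun_apply (f' (x + (u + z)))) (at u)"
      using has_derivative_compose f'[OF lt(2)[OF u]] by fastforce
    moreover have "((\<lambda>u. x + u) has_derivative (\<lambda>h. h)) (at u)"
      by (auto intro!: derivative_eq_intros)
    then have "((\<lambda>u. f (x + u)) has_derivative blinfun_apply (f' (x + u))) (at u)"
      using has_derivative_compose f'[OF lt(1)[OF u]] by fastforce
    ultimately have "(G has_derivative blinfun_apply (G' u)) (at u)"
      unfolding G_def G'_def
      by (auto intro!: derivative_eq_intros bounded_linear_imp_has_derivative blinfun.bounded_linear_right
          simp: blinfun.bilinear_simps)
    then show "(G has_derivative blinfun_apply (G' u)) (at u within cball 0 (norm y))"
      by (rule has_derivative_at_withinI)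
    have "G' u = (f' (x + (u + z)) - f' x - D (u + z)) - (f' (x + u) - f' x - D u)"
      by (simp add: G'_def linear_add[OF D])
    also have "norm \<dots> \<le> e * norm (u + z) + e * norm u"
      by (rule order_trans[OF norm_triangle_ineq4 add_mono[OF R[OF lt(2)[OF u]] R[OF lt(1)[OF u]]]])
    also have "\<dots> \<le> e * (norm u + norm z) + e * norm u"
      by (intro add_right_mono mult_left_mono norm_triangle_ineq e)
    also have "\<dots> = e * (2 * norm u + norm z)"
      by (simp add: algebra_simps)
    also have "\<dots> \<le> e * (2 * (norm y + norm z))"
      using u by (intro mult_left_mono e) (auto simp: dist_norm intro: add_increasing)
    finally show "onorm (blinfun_apply (G' u)) \<le> 2 * e * (norm y + norm z)"
      by (simp add: norm_blinfun.rep_eq algebra_simps)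
  qed auto
  then show ?thesis
    by (simp add: G_def algebra_simps)
qed

text \<open>The second difference is symmetric in its two increments, and \<open>norm_second_difference_le\<close>
  approximates it both by \<open>f'' k h\<close> and by \<open>f'' h k\<close>. For increments \<open>t h\<close> and \<open>t k\<close> the errors are at
  most a small multiple of \<open>t\<^sup>2\<close>, so the two limits agree.\<close>

lemma second_derivative_symmetric:
  fixes f :: "'a::real_normed_vector \<Rightarrow> 'b::real_normed_vector" and f' :: "'a \<Rightarrow> 'a \<Rightarrow>\<^sub>L 'b"
  assumes S: "open S" "x \<in> S"
    and f': "\<And>y. y \<in> S \<Longrightarrow> (f has_derivative blinfun_apply (f' y)) (at y)"
    and f'': "(f' has_derivative f'') (at x)"
  shows "f'' h k = f'' k h"
proof -
  let ?n = "2 * (norm h + norm k)\<^sup>2"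
  have lin: "linear f''"
    using f'' by (rule has_derivative_linear)
  have le: "norm (f'' h k - f'' k h) \<le> e * ?n" if e: "0 < e" for e
  proof -
    obtain d1 where d1: "0 < d1" "ball x d1 \<subseteq> S"
      using S open_contains_ball by metis
    obtain d2 where d2: "0 < d2"
      "\<And>y. norm (y - x) < d2 \<Longrightarrow> norm (f' y - f' x - f'' (y - x)) \<le> e * norm (y - x)"
      using f'' e unfolding has_derivative_at_alt by blast
    define d where "d = min d1 d2"
    have der: "(f has_derivative blinfun_apply (f' (x + w))) (at (x + w))" if "norm w < d" for w
      using that d1(2) by (intro f') (auto simp: d_def dist_norm)
    have R: "norm (f' (x + w) - f' x - f'' w) \<le> e * norm w" if "norm w < d" for w
      using that d2(2)[of "x + w"] by (simp add: d_def)
    \<comment> \<open>Any step for which both increments together stay within \<open>d\<close> will do; the summand 1 covers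
      the case \<open>h = k = 0\<close>.\<close>
    define t where "t = d / (2 * (norm h + norm k + 1))"
    have pos: "0 < norm h + norm k + 1"
      by (simp add: add_nonneg_pos)
    have t: "0 < t"
      using d1(1) d2(1) pos by (simp add: t_def d_def)
    have "t * (norm h + norm k) < t * (2 * (norm h + norm k + 1))"
      using t pos by (intro mult_strict_left_mono) auto
    also have "\<dots> = d"
      using pos by (simp add: t_def)
    finally have small: "norm (t *\<^sub>R h) + norm (t *\<^sub>R k) < d"
      using t by (simp add: algebra_simps)
    define \<Delta> where "\<Delta> = f (x + t *\<^sub>R h + t *\<^sub>R k) - f (x + t *\<^sub>R h) - f (x + t *\<^sub>R k) + f x"
    have 1: "norm (\<Delta> - f'' (t *\<^sub>R k) (t *\<^sub>R h)) \<le>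
        2 * e * (norm (t *\<^sub>R h) + norm (t *\<^sub>R k)) * norm (t *\<^sub>R h)"
      unfolding \<Delta>_def by (rule norm_second_difference_le[OF der lin R]) (use e small in auto)
    have "norm (f (x + t *\<^sub>R k + t *\<^sub>R h) - f (x + t *\<^sub>R k) - f (x + t *\<^sub>R h) + f x - f'' (t *\<^sub>R h) (t *\<^sub>R k)) \<le>
        2 * e * (norm (t *\<^sub>R k) + norm (t *\<^sub>R h)) * norm (t *\<^sub>R k)"
      by (rule norm_second_difference_le[OF der lin R]) (use e small in auto)
    then have 2: "norm (\<Delta> - f'' (t *\<^sub>R h) (t *\<^sub>R k)) \<le>
        2 * e * (norm (t *\<^sub>R k) + norm (t *\<^sub>R h)) * norm (t *\<^sub>R k)"
      by (simp add: \<Delta>_def algebra_simps)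
    have "f'' (t *\<^sub>R h) (t *\<^sub>R k) - f'' (t *\<^sub>R k) (t *\<^sub>R h) = t\<^sup>2 *\<^sub>R (f'' h k - f'' k h)"
      by (simp add: linear_scale[OF lin] blinfun.bilinear_simps power2_eq_square scaleR_diff_right)
    moreover have "f'' (t *\<^sub>R h) (t *\<^sub>R k) - f'' (t *\<^sub>R k) (t *\<^sub>R h)
        = (\<Delta> - f'' (t *\<^sub>R k) (t *\<^sub>R h)) - (\<Delta> - f'' (t *\<^sub>R h) (t *\<^sub>R k))"
      by simp
    ultimately have "t\<^sup>2 * norm (f'' h k - f'' k h) \<le>
        2 * e * (norm (t *\<^sub>R h) + norm (t *\<^sub>R k)) * norm (t *\<^sub>R h) +
        2 * e * (norm (t *\<^sub>R k) + norm (t *\<^sub>R h)) * norm (t *\<^sub>R k)"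
      using order_trans[OF norm_triangle_ineq4 add_mono[OF 1 2]] by (metis norm_scaleR abs_power2)
    also have "\<dots> = t\<^sup>2 * (e * ?n)"
      using t by (simp add: power2_eq_square algebra_simps)
    finally show ?thesis
      using t by simp
  qed
  have "norm (f'' h k - f'' k h) \<le> 0 + r" if r: "0 < r" for r
  proof -
    have "norm (f'' h k - f'' k h) \<le> r / (?n + 1) * ?n"
      using r by (intro le) (simp add: add_nonneg_pos)
    also have "\<dots> \<le> r / (?n + 1) * (?n + 1)"
      using r by (intro mult_left_mono) auto
    also have "\<dots> = r"
    proof -
      have "?n + 1 \<noteq> 0" using zero_le_power2[of "norm h + norm k"] by linarith
      then show ?thesis by (rule nonzero_divide_eq_eq[THEN iffD1, OF _ refl, symmetric])
    qed
    finally show ?thesis by simp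
  qed
  then have "norm (f'' h k - f'' k h) \<le> 0"
    by (rule field_le_epsilon)
  then show ?thesis
    by simp
qed

text \<open>Differentiating \<open>X' (f y) = f' y (X y)\<close> gives the first-order term \<open>f' x\<close> of the derivative of
  \<open>X\<close> plus a term with the second derivative of \<open>f\<close>, applied to \<open>X\<close> and to the direction. In the
  commutator the second-order terms appear as \<open>f'' X Y - f'' Y X\<close> and cancel by symmetry. Thus the
  coordinate bracket of \<open>f\<close>-related fields is \<open>f\<close>-related.\<close>

lemma bracket_natural:
  fixes f :: "'a::real_normed_vector \<Rightarrow> 'b::real_normed_vector" and f' :: "'a \<Rightarrow> 'a \<Rightarrow>\<^sub>L 'b"
  assumes S: "open S" "x \<in> S"
    and f': "\<And>y. y \<in> S \<Longrightarrow> (f has_derivative blinfun_apply (f' y)) (at y)"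
    and f'': "f' differentiable at x"
    and X: "X differentiable at x" "X' differentiable at (f x)"
      "\<And>y. y \<in> S \<Longrightarrow> X' (f y) = f' y (X y)"
    and Y: "Y differentiable at x" "Y' differentiable at (f x)"
      "\<And>y. y \<in> S \<Longrightarrow> Y' (f y) = f' y (Y y)"
  shows "frechet_derivative Y' (at (f x)) (X' (f x)) - frechet_derivative X' (at (f x)) (Y' (f x))
       = f' x (frechet_derivative Y (at x) (X x) - frechet_derivative X (at x) (Y x))"
proof -
  obtain f'' where f'': "(f' has_derivative f'') (at x)"
    using f'' by (auto simp: differentiable_def)
  have push: "frechet_derivative Z' (at (f x)) (f' x h)
      = f' x (frechet_derivative Z (at x) h) + f'' h (Z x)"
    if Z: "Z differentiable at x" "Z' differentiable at (f x)"
      "\<And>y. y \<in> S \<Longrightarrow> Z' (f y) = f' y (Z y)" for Z Z' h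
  proof -
    have "((\<lambda>y. Z' (f y)) has_derivative (\<lambda>h. frechet_derivative Z' (at (f x)) (f' x h))) (at x)"
      using has_derivative_compose[OF f'[OF S(2)]] Z(2) frechet_derivative_works by blast
    moreover have "((\<lambda>y. f' y (Z y)) has_derivative
        (\<lambda>h. f' x (frechet_derivative Z (at x) h) + f'' h (Z x))) (at x)"
      using blinfun.FDERIV[OF f''] Z(1) frechet_derivative_works by blast
    then have "((\<lambda>y. Z' (f y)) has_derivative
        (\<lambda>h. f' x (frechet_derivative Z (at x) h) + f'' h (Z x))) (at x)"
      by (rule has_derivative_transform_within_open[OF _ S]) (simp add: Z(3))
    ultimately show ?thesis
      using has_derivative_unique by metis
  qed
  show ?thesis
    using second_derivative_symmetric[OF S f' f'', of "X x" "Y x"]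
    by (simp add: X(3)[OF S(2)] Y(3)[OF S(2)] push[OF X] push[OF Y] blinfun.diff_right)
qed

section \<open>Maps of class \<open>C\<^sup>1\<close>\<close>

lemma C1_on_const: "C1_on S (\<lambda>x. a)"
  unfolding C1_on_def by (intro exI[of _ "\<lambda>x. 0"]) (auto simp: zero_blinfun.rep_eq)

lemma has_derivative_at_imp_continuous_on:
  assumes "\<And>x. x \<in> S \<Longrightarrow> (f has_derivative f' x) (at x)"
  shows "continuous_on S f"
  using assms by (intro has_derivative_continuous_on) (rule has_derivative_at_withinI)

lemma C1_on_differentiable:
  assumes "C1_on S f" "x \<in> S"
  shows "f differentiable at x"
  using assms by (auto simp: C1_on_def differentiable_def)

lemma C1_on_subset: "C1_on S f \<Longrightarrow> T \<subseteq> S \<Longrightarrow> C1_on T f"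
  unfolding C1_on_def using continuous_on_subset by blast

lemma C2_on_imp_C1_on: "C2_on S f \<Longrightarrow> C1_on S f"
  unfolding C2_on_def C1_on_def by (meson has_derivative_at_imp_continuous_on)

lemma C1_on_cong_open:
  assumes "C1_on S f" "open S" "\<And>x. x \<in> S \<Longrightarrow> f x = g x"
  shows "C1_on S g"
  using assms has_derivative_transform_within_open unfolding C1_on_def by metis

text \<open>A field that is given by one formula near its support and vanishes off the support is shown to be
  \<open>C\<^sup>1\<close> by gluing; on the overlap the two derivatives agree by uniqueness.\<close>

lemma C1_on_Un:
  fixes f :: "'a::real_normed_vector \<Rightarrow> 'b::real_normed_vector"
  assumes "open S" "open T" "C1_on S f" "C1_on T f"
  shows "C1_on (S \<union> T) f"
proof -
  obtain g h where g: "\<And>x. x \<in> S \<Longrightarrow> (f has_derivative blinfun_apply (g x)) (at x)" "continuous_on S g"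
    and h: "\<And>x. x \<in> T \<Longrightarrow> (f has_derivative blinfun_apply (h x)) (at x)" "continuous_on T h"
    using assms by (auto simp: C1_on_def)
  define k where "k x = (if x \<in> S then g x else h x)" for x
  have kS: "k x = g x" if "x \<in> S" for x
    using that by (simp add: k_def)
  have kT: "k x = h x" if "x \<in> T" for x
    using that g(1) h(1) has_derivative_unique by (metis k_def blinfun_apply_inject)
  have "continuous_on (S \<union> T) k"
    using g(2) h(2) by (intro continuous_on_open_Un assms) (simp_all add: kS kT cong: continuous_on_cong)
  then show ?thesis
    unfolding C1_on_def using g(1) h(1) kS kT by (metis Un_iff)
qed

lemma C1_on_compose:
  assumes f: "C1_on S f" and g: "C1_on T g" and "f ` S \<subseteq> T"
  shows "C1_on S (\<lambda>x. g (f x))"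
proof -
  obtain f' g' where f': "\<And>x. x \<in> S \<Longrightarrow> (f has_derivative blinfun_apply (f' x)) (at x)" "continuous_on S f'"
    and g': "\<And>x. x \<in> T \<Longrightarrow> (g has_derivative blinfun_apply (g' x)) (at x)" "continuous_on T g'"
    using f g by (auto simp: C1_on_def)
  have "continuous_on S f"
    using f'(1) by (rule has_derivative_at_imp_continuous_on)
  then have "continuous_on S (\<lambda>x. g' (f x) o\<^sub>L f' x)"
    using assms(3) by (intro bounded_bilinear.continuous_on[OF bounded_bilinear_blinfun_compose]
        continuous_on_compose2[OF g'(2)] f'(2))
  moreover have "((\<lambda>x. g (f x)) has_derivative blinfun_apply (g' (f x) o\<^sub>L f' x)) (at x)" if "x \<in> S" for x
    using has_derivative_compose[OF f'(1)[OF that] g'(1)] that assms(3) 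
    by (auto simp: blinfun_compose.rep_eq o_def)
  ultimately show ?thesis
    unfolding C1_on_def by (intro exI[of _ "\<lambda>x. g' (f x) o\<^sub>L f' x"]) auto
qed

lemma C1_on_bounded_linear: "bounded_linear f \<Longrightarrow> C1_on S f"
  unfolding C1_on_def
  by (intro exI[of _ "\<lambda>x. Blinfun f"]) (auto simp: bounded_linear_Blinfun_apply bounded_linear_imp_has_derivative)

lemma C1_on_scaleR:
  fixes f :: "'a::real_normed_vector \<Rightarrow> real"
  assumes "C1_on S f" "C1_on S g"
  shows "C1_on S (\<lambda>x. f x *\<^sub>R g x)"
proof -
  obtain f' g' where f': "\<And>x. x \<in> S \<Longrightarrow> (f has_derivative blinfun_apply (f' x)) (at x)" "continuous_on S f'"
    and g': "\<And>x. x \<in> S \<Longrightarrow> (g has_derivative blinfun_apply (g' x)) (at x)" "continuous_on S g'"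
    using assms by (auto simp: C1_on_def)
  let ?h = "\<lambda>x. f x *\<^sub>R g' x + (blinfun_scaleR_left (g x) o\<^sub>L f' x)"
  have "continuous_on S f" "continuous_on S g"
    by (rule has_derivative_at_imp_continuous_on, erule f'(1) g'(1))+
  then have "continuous_on S ?h"
    by (intro continuous_intros f'(2) g'(2) bounded_bilinear.continuous_on[OF bounded_bilinear_blinfun_compose]
        bounded_linear.continuous_on[OF bounded_linear_blinfun_scaleR_left])
  moreover have "((\<lambda>x. f x *\<^sub>R g x) has_derivative blinfun_apply (?h x)) (at x)" if "x \<in> S" for x
    using has_derivative_scaleR[OF f'(1)[OF that] g'(1)[OF that]]
    by (simp add: blinfun.bilinear_simps plus_blinfun.rep_eq scaleR_blinfun.rep_eq blinfun_compose.rep_eq o_def)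
  ultimately show ?thesis
    unfolding C1_on_def by (intro exI[of _ ?h]) auto
qed

lemma C1_on_real:
  fixes f f' :: "real \<Rightarrow> real"
  assumes "\<And>x. (f has_real_derivative f' x) (at x)" "continuous_on UNIV f'"
  shows "C1_on UNIV f"
proof -
  have "continuous_on UNIV (\<lambda>x. blinfun_mult_right (f' x))"
    by (intro bounded_linear.continuous_on[OF bounded_linear_blinfun_mult_right] assms)
  then show ?thesis
    using assms(1) unfolding C1_on_def has_field_derivative_def
    by (intro exI[of _ "\<lambda>x. blinfun_mult_right (f' x)"]) (auto simp: blinfun_mult_right.rep_eq)
qed

text \<open>The simplest profile that is \<open>C\<^sup>1\<close> and vanishes on a half-line: the square makes the derivative
  \<open>2 max 0 t\<close> continuous across \<open>0\<close>.\<close>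

lemma C1_on_max_0_square: "C1_on UNIV (\<lambda>t::real. (max 0 t)\<^sup>2)"
proof (rule C1_on_real[where f' = "\<lambda>t. 2 * max 0 t"])
  fix t :: real
  consider "t < 0" | "t = 0" | "0 < t" by linarith
  then show "((\<lambda>t. (max 0 t)\<^sup>2) has_real_derivative 2 * max 0 t) (at t)"
  proof cases
    case 1
    have "((\<lambda>t. 0) has_real_derivative 2 * max 0 t) (at t)"
      using 1 by (simp add: max_def)
    then show ?thesis
      by (rule has_field_derivative_transform_within_open[where S = "{..<0}"]) (use 1 in auto)
  next
    case 3
    have "((\<lambda>t. t\<^sup>2) has_real_derivative 2 * max 0 t) (at t)"
      using 3 by (auto intro!: derivative_eq_intros)
    then show ?thesis
      by (rule has_field_derivative_transform_within_open[where S = "{0<..}"]) (use 3 in auto)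
  next
    case 2
    have "((\<lambda>h::real. max 0 h) \<longlongrightarrow> max 0 0) (at 0)"
      by (intro tendsto_intros)
    then have "((\<lambda>h::real. (max 0 h)\<^sup>2 / h) \<longlongrightarrow> 0) (at 0)"
      by (rule Lim_transform_within[where d = 1, THEN tendsto_eq_rhs]) (auto simp: max_def power2_eq_square)
    then show ?thesis
      using 2 by (simp add: DERIV_def)
  qed
qed (intro continuous_intros)

lemma C1_bump_exists:
  fixes x :: "'a::euclidean_space"
  assumes "0 < r"
  shows "\<exists>\<beta>::'a \<Rightarrow> real. C1_on UNIV \<beta> \<and> \<beta> x = 1 \<and> (\<forall>y. r \<le> dist x y \<longrightarrow> \<beta> y = 0)"
proof -
  \<comment> \<open>The square of the norm, unlike the norm, is differentiable at the centre as well; \<open>q\<close> is positive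
    exactly inside the ball.\<close>
  define q where "q y = 1 - (norm (y - x))\<^sup>2 / r\<^sup>2" for y
  let ?q' = "\<lambda>y. blinfun_scaleR_left (- 2 / r\<^sup>2) o\<^sub>L blinfun_inner_right (y - x)"
  have "(q has_derivative blinfun_apply (?q' y)) (at y)" for y
    unfolding q_def power2_norm_eq_inner
    using assms
    by (auto intro!: derivative_eq_intros
        simp: blinfun_inner_right.rep_eq blinfun_compose.rep_eq fun_eq_iff inner_commute field_simps)
  moreover have "continuous_on UNIV ?q'"
    by (intro continuous_intros bounded_linear.continuous_on[OF bounded_linear_blinfun_inner_right]
        bounded_bilinear.continuous_on[OF bounded_bilinear_blinfun_compose])
  ultimately have "C1_on UNIV q"
    unfolding C1_on_def by (intro exI[of _ ?q']) simp
  then have "C1_on UNIV (\<lambda>y. (max 0 (q y))\<^sup>2)"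
    by (rule C1_on_compose[OF _ C1_on_max_0_square]) auto
  moreover have "(max 0 (q y))\<^sup>2 = 0" if "r \<le> dist x y" for y
  proof -
    have "r\<^sup>2 \<le> (norm (y - x))\<^sup>2"
      using that assms by (intro power_mono) (auto simp: dist_norm norm_minus_commute)
    then have "q y \<le> 0"
      using assms by (simp add: q_def)
    then show ?thesis by (simp add: max_def)
  qed
  ultimately show ?thesis
    by (intro exI[of _ "\<lambda>y. (max 0 (q y))\<^sup>2"]) (simp add: q_def)
qed

section \<open>Charts and tangent vectors\<close>

lemma sum_fun_eval: "(\<Sum>i\<in>I. f i) x = (\<Sum>i\<in>I. f i x)"
  by (induction I rule: infinite_finite_induct) auto

lemma charts_atD: "c \<in> charts_at A p \<Longrightarrow> c \<in> A" "c \<in> charts_at A p \<Longrightarrow> p \<in> fst c"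
  by (auto simp: charts_at_def)

lemma tangent_space_transform:
  "v \<in> tangent_space A p \<Longrightarrow> c \<in> charts_at A p \<Longrightarrow> d \<in> charts_at A p \<Longrightarrow>
   v d = frechet_derivative (transition c d) (at (snd c p)) (v c)"
  unfolding tangent_space_def by blast

lemma tangent_space_outside: "v \<in> tangent_space A p \<Longrightarrow> c \<notin> charts_at A p \<Longrightarrow> v c = 0"
  unfolding tangent_space_def by blast

lemma tangent_spaceI:
  assumes "\<And>c d. c \<in> charts_at A p \<Longrightarrow> d \<in> charts_at A p \<Longrightarrow>
      v d = frechet_derivative (transition c d) (at (snd c p)) (v c)"
    and "\<And>c. c \<notin> charts_at A p \<Longrightarrow> v c = 0"
  shows "v \<in> tangent_space A p"
  using assms unfolding tangent_space_def by blast

lemma C1_vector_fields_tangent: "X \<in> C1_vector_fields A U \<Longrightarrow> p \<in> U \<Longrightarrow> X p \<in> tangent_space A p"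
  by (auto simp: C1_vector_fields_def)

lemma C1_vector_fields_C1:
  "X \<in> C1_vector_fields A U \<Longrightarrow> c \<in> A \<Longrightarrow> C1_on (snd c ` (fst c \<inter> U)) (local_rep X c)"
  unfolding C1_vector_fields_def by blast

context
  fixes M :: "'m topology" and A :: "('m, 'n::finite) chart set"
  assumes mfd: "differentiable_manifold M A"
begin

lemma chart_domain_open: "c \<in> A \<Longrightarrow> openin M (fst c)"
  using mfd by (simp add: differentiable_manifold_def)

lemma chart_range_open: "c \<in> A \<Longrightarrow> open (snd c ` fst c)"
  using mfd by (simp add: differentiable_manifold_def)

lemma chart_homeomorphic:
  "c \<in> A \<Longrightarrow> homeomorphic_map (subtopology M (fst c)) (top_of_set (snd c ` fst c)) (snd c)"
  using mfd by (simp add: differentiable_manifold_def)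

lemma chart_inv_chart:
  assumes "c \<in> A" "p \<in> fst c"
  shows "chart_inv c (snd c p) = p"
proof -
  have "topspace (subtopology M (fst c)) = fst c"
    using openin_subset[OF chart_domain_open[OF assms(1)]] by auto
  then have "inj_on (snd c) (fst c)"
    using homeomorphic_imp_injective_map[OF chart_homeomorphic[OF assms(1)]] by simp
  then show ?thesis
    using assms(2) by (simp add: chart_inv_def)
qed

lemma chart_image_open:
  assumes c: "c \<in> A" and U: "openin M U"
  shows "open (snd c ` (fst c \<inter> U))"
proof -
  have "openin (subtopology M (fst c)) (fst c \<inter> U)"
    using U by (auto simp: openin_subtopology)
  then have "openin (top_of_set (snd c ` fst c)) (snd c ` (fst c \<inter> U))"
    using homeomorphic_imp_open_map[OF chart_homeomorphic[OF c]] by (simp add: open_map_def)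
  moreover have "open (snd c ` fst c)"
    by (rule chart_range_open[OF c])
  ultimately show ?thesis
    using openin_open_trans by blast
qed

lemma transition_chart: "c \<in> A \<Longrightarrow> p \<in> fst c \<Longrightarrow> transition c d (snd c p) = snd d p"
  by (simp add: transition_def chart_inv_chart)

lemma local_rep_chart: "c \<in> A \<Longrightarrow> p \<in> fst c \<Longrightarrow> local_rep X c (snd c p) = X p c"
  by (simp add: local_rep_def chart_inv_chart)

lemma charts_at_exist: "p \<in> topspace M \<Longrightarrow> charts_at A p \<noteq> {}"
  using mfd unfolding differentiable_manifold_def charts_at_def by blast

lemma overlap_open:
  assumes "c \<in> A" "d \<in> A"
  shows "open (snd c ` (fst c \<inter> fst d))"
  by (rule chart_image_open[OF assms(1) chart_domain_open[OF assms(2)]])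

text \<open>The derivative of a transition map, available both as a \<open>C\<^sup>1\<close> family of bounded linear maps
  and as the \<open>frechet_derivative\<close> that the transformation law is written with.\<close>

lemma transition_C2:
  assumes "c \<in> A" "d \<in> A"
  obtains \<phi>' where
    "\<And>y. y \<in> snd c ` (fst c \<inter> fst d) \<Longrightarrow>
       (transition c d has_derivative blinfun_apply (\<phi>' y)) (at y)"
    "\<And>y. y \<in> snd c ` (fst c \<inter> fst d) \<Longrightarrow>
       frechet_derivative (transition c d) (at y) = blinfun_apply (\<phi>' y)"
    "C1_on (snd c ` (fst c \<inter> fst d)) \<phi>'"
proof -
  have "C2_on (snd c ` (fst c \<inter> fst d)) (transition c d)"
    using mfd assms unfolding differentiable_manifold_def by blast
  then obtain \<phi>' where
    \<phi>': "\<And>y. y \<in> snd c ` (fst c \<inter> fst d) \<Longrightarrow>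
       (transition c d has_derivative blinfun_apply (\<phi>' y)) (at y)"
    "C1_on (snd c ` (fst c \<inter> fst d)) \<phi>'"
    unfolding C2_on_def by blast
  show thesis
    by (rule that[OF \<phi>'(1) _ \<phi>'(2)]) (simp_all add: frechet_derivative_at[OF \<phi>'(1), symmetric])
qed

lemma transition_differentiable:
  assumes "c \<in> charts_at A p" "d \<in> charts_at A p"
  shows "transition c d differentiable at (snd c p)"
proof -
  have p: "snd c p \<in> snd c ` (fst c \<inter> fst d)"
    using charts_atD(2)[OF assms(1)] charts_atD(2)[OF assms(2)] by blast
  show ?thesis
    by (rule transition_C2[OF charts_atD(1)[OF assms(1)] charts_atD(1)[OF assms(2)]])
      (rule differentiableI, drule meta_spec, erule meta_mp, rule p)
qed

text \<open>The chain rule for \<open>transition c e = transition d e \<circ> transition c d\<close>, which holds near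
  \<open>snd c p\<close> only.\<close>

lemma transition_derivative_cocycle:
  assumes c: "c \<in> charts_at A p" and d: "d \<in> charts_at A p" and e: "e \<in> charts_at A p"
  shows "frechet_derivative (transition d e) (at (snd d p))
           (frechet_derivative (transition c d) (at (snd c p)) h) =
         frechet_derivative (transition c e) (at (snd c p)) h"
proof -
  note A = charts_atD[OF c] charts_atD[OF d] charts_atD[OF e]
  have "frechet_derivative (transition d e \<circ> transition c d) (at (snd c p)) =
      frechet_derivative (transition c e) (at (snd c p))"
  proof (rule sym, rule frechet_derivative_transform_within_open)
    show "transition c e differentiable at (snd c p)"
      by (rule transition_differentiable[OF c e])
    show "open (snd c ` (fst c \<inter> fst d))"
      by (rule overlap_open[OF A(1,3)])
    show "snd c p \<in> snd c ` (fst c \<inter> fst d)"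
      using A by auto
  next
    fix y assume "y \<in> snd c ` (fst c \<inter> fst d)"
    then show "transition c e y = (transition d e \<circ> transition c d) y"
      using A by (auto simp: transition_chart)
  qed
  then show ?thesis
    using frechet_derivative_compose[of "transition c d" "snd c p" "transition d e"]
      transition_differentiable[OF c d] transition_differentiable[OF d e]
    by (simp add: transition_chart A fun_eq_iff)
qed

lemma transition_derivative_linear:
  assumes "c \<in> charts_at A p" "d \<in> charts_at A p"
  shows "linear (frechet_derivative (transition c d) (at (snd c p)))"
  by (rule linear_frechet_derivative[OF transition_differentiable[OF assms]])

lemma subspace_tangent_space: "subspace (tangent_space A p)"
proof (rule subspaceI)
  show "0 \<in> tangent_space A p"
    by (rule tangent_spaceI) (simp_all add: linear_0 transition_derivative_linear)
next
  fix u v assume uv: "u \<in> tangent_space A p" "v \<in> tangent_space A p"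
  show "u + v \<in> tangent_space A p"
  proof (rule tangent_spaceI)
    fix c d assume cd: "c \<in> charts_at A p" "d \<in> charts_at A p"
    show "(u + v) d = frechet_derivative (transition c d) (at (snd c p)) ((u + v) c)"
      using uv[THEN tangent_space_transform, OF cd]
      by (simp add: linear_add[OF transition_derivative_linear[OF cd]])
  qed (simp add: uv[THEN tangent_space_outside])
next
  fix s v assume v: "v \<in> tangent_space A p"
  show "s *\<^sub>R v \<in> tangent_space A p"
  proof (rule tangent_spaceI)
    fix c d assume cd: "c \<in> charts_at A p" "d \<in> charts_at A p"
    show "(s *\<^sub>R v) d = frechet_derivative (transition c d) (at (snd c p)) ((s *\<^sub>R v) c)"
      using tangent_space_transform[OF v cd]
      by (simp add: scaleR_fun_def linear_scale[OF transition_derivative_linear[OF cd]])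
  qed (simp add: scaleR_fun_def tangent_space_outside[OF v])
qed

lemma local_rep_differentiable:
  assumes "X \<in> C1_vector_fields A U" "p \<in> U" "c \<in> charts_at A p"
  shows "local_rep X c differentiable at (snd c p)"
proof (rule C1_on_differentiable)
  show "C1_on (snd c ` (fst c \<inter> U)) (local_rep X c)"
    by (rule C1_vector_fields_C1[OF assms(1) charts_atD(1)[OF assms(3)]])
  show "snd c p \<in> snd c ` (fst c \<inter> U)"
    using charts_atD(2)[OF assms(3)] assms(2) by blast
qed

text \<open>The local representatives of one field in two charts are related by the transition map, so
  \<open>bracket_natural\<close> is the contravariant law for their bracket.\<close>

lemma lie_bracket_tangent:
  assumes X: "X \<in> C1_vector_fields A U" "openin M U" "p \<in> U"
    and Y: "Y \<in> C1_vector_fields A V" "openin M V" "p \<in> V"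
  shows "lie_bracket A X Y p \<in> tangent_space A p"
proof -
  have "lie_bracket A X Y p d = frechet_derivative (transition c d) (at (snd c p)) (lie_bracket A X Y p c)"
    if c: "c \<in> charts_at A p" and d: "d \<in> charts_at A p" for c d
  proof -
    note A = charts_atD[OF c] charts_atD[OF d]
    obtain \<phi>' where \<phi>': "\<And>y. y \<in> snd c ` (fst c \<inter> fst d) \<Longrightarrow>
         (transition c d has_derivative blinfun_apply (\<phi>' y)) (at y)"
      "\<And>y. y \<in> snd c ` (fst c \<inter> fst d) \<Longrightarrow>
         frechet_derivative (transition c d) (at y) = blinfun_apply (\<phi>' y)"
      "C1_on (snd c ` (fst c \<inter> fst d)) \<phi>'"
      by (rule transition_C2[OF A(1,3)]) blast
    let ?S = "snd c ` (fst c \<inter> (fst d \<inter> (U \<inter> V)))"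
    have S: "open ?S" "snd c p \<in> ?S"
      using A X Y by (auto intro!: chart_image_open chart_domain_open)
    have p: "snd c p \<in> snd c ` (fst c \<inter> fst d)"
      using A by auto
    have related: "local_rep Z d (transition c d y) = \<phi>' y (local_rep Z c y)"
      if Z: "Z \<in> C1_vector_fields A W" "U \<inter> V \<subseteq> W" and y: "y \<in> ?S" for Z W y
    proof -
      obtain q where q: "q \<in> fst c" "q \<in> fst d" "q \<in> W" "y = snd c q"
        using y Z(2) by auto
      then have cq: "c \<in> charts_at A q" and dq: "d \<in> charts_at A q"
        and y': "snd c q \<in> snd c ` (fst c \<inter> fst d)"
        using A by (auto simp: charts_at_def)
      show ?thesis
        using tangent_space_transform[OF C1_vector_fields_tangent[OF Z(1) q(3)] cq dq]
        by (simp only: q(4) transition_chart[OF A(1) q(1)] local_rep_chart[OF A(1) q(1)]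
            local_rep_chart[OF A(3) q(2)] \<phi>'(2)[OF y'])
    qed
    have "frechet_derivative (local_rep Y d) (at (transition c d (snd c p))) (local_rep X d (transition c d (snd c p)))
        - frechet_derivative (local_rep X d) (at (transition c d (snd c p))) (local_rep Y d (transition c d (snd c p)))
        = \<phi>' (snd c p) (frechet_derivative (local_rep Y c) (at (snd c p)) (local_rep X c (snd c p))
        - frechet_derivative (local_rep X c) (at (snd c p)) (local_rep Y c (snd c p)))"
      using A X Y c d
      by (intro bracket_natural[OF S \<phi>'(1)] related C1_on_differentiable[OF \<phi>'(3) p])
        (auto simp: transition_chart intro: local_rep_differentiable)
    then show ?thesis
      using A c d by (simp add: lie_bracket_def transition_chart local_rep_chart \<phi>'(2)[OF p])
  qed
  then show ?thesis
    by (rule tangent_spaceI) (simp_all add: lie_bracket_def)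
qed

text \<open>A single component vector \<open>h\<close> in one chart already determines a tangent vector; the cocycle law
  makes its components in the other charts consistent.\<close>

lemma tangent_space_of_chart_vector:
  assumes "c \<in> charts_at A p"
  shows "(\<lambda>d. if d \<in> charts_at A p then frechet_derivative (transition c d) (at (snd c p)) h else 0)
           \<in> tangent_space A p"
  using assms by (intro tangent_spaceI) (simp_all add: transition_derivative_cocycle)

section \<open>Extension of tangent vectors\<close>

text \<open>The field with constant components \<open>h\<close> in the chart \<open>c\<close>, scaled by \<open>\<beta>\<close>, seen in another chart
  \<open>d\<close>. Its components there contain one derivative of the transition map, so a \<open>C\<^sup>2\<close> atlas makes them
  \<open>C\<^sup>1\<close>.\<close>

lemma chart_vector_field_C1:
  assumes c: "c \<in> A" and d: "d \<in> A" and \<beta>: "C1_on UNIV \<beta>"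
    and X: "\<And>q. q \<in> fst c \<inter> fst d \<Longrightarrow>
      X q d = \<beta> (snd c q) *\<^sub>R frechet_derivative (transition c d) (at (snd c q)) h"
  shows "C1_on (snd d ` (fst d \<inter> fst c)) (local_rep X d)"
proof -
  obtain \<phi>' where \<phi>': "\<And>y. y \<in> snd c ` (fst c \<inter> fst d) \<Longrightarrow>
       frechet_derivative (transition c d) (at y) = blinfun_apply (\<phi>' y)"
    "C1_on (snd c ` (fst c \<inter> fst d)) \<phi>'"
    by (rule transition_C2[OF c d]) blast
  have "C1_on (snd c ` (fst c \<inter> fst d)) (\<lambda>x. \<phi>' x h)"
    by (rule C1_on_compose[OF \<phi>'(2) C1_on_bounded_linear[of "\<lambda>T. blinfun_apply T h" UNIV]])
      (auto intro: blinfun.bounded_linear_left)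
  then have F: "C1_on (snd c ` (fst c \<inter> fst d)) (\<lambda>x. \<beta> x *\<^sub>R \<phi>' x h)"
    by (intro C1_on_scaleR C1_on_subset[OF \<beta>]) auto
  have "C1_on (snd d ` (fst d \<inter> fst c)) (transition d c)"
    using mfd c d by (intro C2_on_imp_C1_on) (simp add: differentiable_manifold_def)
  then have "C1_on (snd d ` (fst d \<inter> fst c))
      (\<lambda>y. \<beta> (transition d c y) *\<^sub>R \<phi>' (transition d c y) h)"
    by (rule C1_on_compose[OF _ F]) (use d in \<open>auto simp: transition_chart\<close>)
  then show ?thesis
  proof (rule C1_on_cong_open[OF _ overlap_open[OF d c]])
    fix y assume "y \<in> snd d ` (fst d \<inter> fst c)"
    then show "\<beta> (transition d c y) *\<^sub>R \<phi>' (transition d c y) h = local_rep X d y"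
      using d by (auto simp: transition_chart local_rep_chart X \<phi>'(1))
  qed
qed

text \<open>A set that is compact in the coordinates of one chart is compact in the manifold, hence closed by
  the Hausdorff property. Without it, the extension by zero of a field supported in a chart could be
  discontinuous at points outside the chart.\<close>

lemma chart_preimage_closed:
  assumes c: "c \<in> A" and K: "compact K" "K \<subseteq> snd c ` fst c"
  shows "closedin M {q \<in> fst c. snd c q \<in> K}"
proof -
  let ?K = "{q \<in> fst c. snd c q \<in> K}"
  have "?K \<subseteq> topspace (subtopology M (fst c))"
    using openin_subset[OF chart_domain_open[OF c]] by auto
  moreover have "snd c ` ?K = K"
    using K(2) by auto
  ultimately have "compactin (subtopology M (fst c)) ?K"
    using homeomorphic_map_compactness[OF chart_homeomorphic[OF c], of ?K] K
    by (simp add: compactin_subtopology)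
  then have "compactin M ?K"
    by (simp add: compactin_subtopology)
  then show ?thesis
    using mfd by (intro compactin_imp_closedin) (simp_all add: differentiable_manifold_def)
qed

text \<open>The vector is spread with constant components over a chart and cut off by a bump function; outside
  the chart the field is zero. In every chart \<open>d\<close> the result is \<open>C\<^sup>1\<close> on two open sets that cover
  its domain: the overlap with \<open>c\<close>, where the formula holds, and the complement of the compact
  support, where the field is zero.\<close>

lemma tangent_vector_extends:
  assumes p: "p \<in> topspace M" and v: "v \<in> tangent_space A p"
  shows "\<exists>X\<in>C1_vector_fields A (topspace M). X p = v"
proof -
  obtain c where c: "c \<in> charts_at A p"
    using charts_at_exist[OF p] by blast
  note cA = charts_atD[OF c]
  have "open (snd c ` fst c)"
    by (rule chart_range_open[OF cA(1)])
  then obtain r where r: "0 < r" "cball (snd c p) r \<subseteq> snd c ` fst c"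
    using cA(2) open_contains_cball by (metis imageI)
  obtain \<beta> :: "real ^ 'n \<Rightarrow> real" where \<beta>: "C1_on UNIV \<beta>" "\<beta> (snd c p) = 1"
    "\<And>y. r \<le> dist (snd c p) y \<Longrightarrow> \<beta> y = 0"
    using C1_bump_exists[OF r(1)] by metis
  define w where "w q d = (if q \<in> fst c then
      \<beta> (snd c q) *\<^sub>R (if d \<in> charts_at A q then frechet_derivative (transition c d) (at (snd c q)) (v c) else 0)
      else 0)" for q d
  define X where "X = restrict w (topspace M)"
  have "w q \<in> tangent_space A q" if q: "q \<in> topspace M" for q
  proof (cases "q \<in> fst c")
    case True
    then have "c \<in> charts_at A q"
      using cA by (simp add: charts_at_def)
    then have "\<beta> (snd c q) *\<^sub>R (\<lambda>d. if d \<in> charts_at A q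
        then frechet_derivative (transition c d) (at (snd c q)) (v c) else 0) \<in> tangent_space A q"
      by (intro subspace_scale subspace_tangent_space tangent_space_of_chart_vector)
    then show ?thesis
      using True by (simp add: w_def[abs_def] scaleR_fun_def)
  next
    case False
    then have "w q = 0"
      by (simp add: w_def fun_eq_iff)
    then show ?thesis
      using subspace_0[OF subspace_tangent_space] by simp
  qed
  then have "X \<in> Pi\<^sub>E (topspace M) (tangent_space A)"
    by (auto simp: X_def)
  moreover have "C1_on (snd d ` (fst d \<inter> topspace M)) (local_rep X d)" if d: "d \<in> A" for d
  proof -
    define K where "K = {q \<in> fst c. snd c q \<in> cball (snd c p) r}"
    have K: "openin M (topspace M - K)"
      using chart_preimage_closed[OF cA(1) compact_cball r(2)] by (simp add: K_def openin_diff)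
    have sub: "fst c \<subseteq> topspace M" "fst d \<subseteq> topspace M"
      using openin_subset chart_domain_open cA(1) d by blast+
    have 1: "C1_on (snd d ` (fst d \<inter> fst c)) (local_rep X d)"
      by (rule chart_vector_field_C1[OF cA(1) d \<beta>(1), where h = "v c"])
        (use d sub in \<open>auto simp: X_def w_def charts_at_def\<close>)
    have 2: "C1_on (snd d ` (fst d \<inter> (topspace M - K))) (local_rep X d)"
    proof (rule C1_on_cong_open[OF C1_on_const[of _ 0] chart_image_open[OF d K]])
      fix y assume "y \<in> snd d ` (fst d \<inter> (topspace M - K))"
      then obtain q where q: "q \<in> fst d" "q \<in> topspace M" "q \<notin> K" "y = snd d q"
        by auto
      then have "w q d = 0"
        by (auto simp: w_def K_def \<beta>(3))
      then show "0 = local_rep X d y"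
        using q d by (simp add: local_rep_chart X_def)
    qed
    have "fst d \<inter> topspace M = (fst d \<inter> fst c) \<union> (fst d \<inter> (topspace M - K))"
      using sub by (auto simp: K_def)
    then show ?thesis
      using C1_on_Un[OF overlap_open[OF d cA(1)] chart_image_open[OF d K] 1 2] by (simp add: image_Un)
  qed
  moreover have "X p = v"
  proof (rule ext)
    fix d
    show "X p d = v d"
    proof (cases "d \<in> charts_at A p")
      case True
      show ?thesis
        using p cA(2) True by (simp add: X_def w_def \<beta>(2) tangent_space_transform[OF v c True])
    next
      case False
      then show ?thesis
        using p cA(2) by (simp add: X_def w_def tangent_space_outside[OF v])
    qed
  qed
  ultimately show ?thesis
    by (auto simp: C1_vector_fields_def)
qed

section \<open>Torsion in a frame of parallel fields\<close>

lemma tensor_field_11_sum: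
  assumes T: "tensor_field_11 M A T" and p: "p \<in> topspace M"
    and v: "\<And>i. i \<in> I \<Longrightarrow> v i \<in> tangent_space A p"
  shows "T p (\<Sum>i\<in>I. a i *\<^sub>R v i) = (\<Sum>i\<in>I. a i *\<^sub>R T p (v i))"
proof -
  have add: "T p (x + y) = T p x + T p y" if "x \<in> tangent_space A p" "y \<in> tangent_space A p" for x y
    using T p that by (auto simp: tensor_field_11_def)
  have scale: "T p (s *\<^sub>R x) = s *\<^sub>R T p x" if "x \<in> tangent_space A p" for s x
    using T p that by (auto simp: tensor_field_11_def)
  have zero: "T p 0 = 0"
    using scale[OF subspace_0[OF subspace_tangent_space], of 0] by (metis scaleR_zero_left)
  show ?thesis
    using v
  proof (induction I rule: infinite_finite_induct)
    case (insert i I)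
    have "T p (a i *\<^sub>R v i + (\<Sum>i\<in>I. a i *\<^sub>R v i)) =
        T p (a i *\<^sub>R v i) + T p (\<Sum>i\<in>I. a i *\<^sub>R v i)"
      using insert.prems
      by (intro add subspace_scale subspace_sum subspace_tangent_space) auto
    then show ?case
      using insert by (simp only: sum.insert[OF insert.hyps] scale insertI1 insertI2)
  qed (simp_all add: zero)
qed

text \<open>Vanishing coefficients mean \<open>D\<^sub>X E\<^sub>j = 0\<close> because \<open>D\<^sub>X E\<^sub>j\<close> lies in the span of the frame: both
  the bracket and the image of \<open>S\<^sub>X\<close> are tangent vectors.\<close>

lemma S_derivation_frame_eq_0:
  assumes S: "is_S_map M A S" and E: "basis_near M A Q E" and W: "components_vanish_on M A S Q E"
    and X: "X \<in> C1_vector_fields A (topspace M)" and p: "p \<in> Q"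
  shows "S_derivation A S X (E j) p = 0"
proof -
  obtain U where U: "openin M U" "Q \<subseteq> U" "\<And>i. E i \<in> C1_vector_fields A U"
    and basis: "\<And>q. q \<in> U \<Longrightarrow> independent (range (\<lambda>i. E i q))"
      "\<And>q. q \<in> U \<Longrightarrow> span (range (\<lambda>i. E i q)) = tangent_space A q"
    using E unfolding basis_near_def by blast
  have pU: "p \<in> U" and pM: "p \<in> topspace M"
    using p U openin_subset by blast+
  let ?v = "S_derivation A S X (E j) p" and ?B = "range (\<lambda>i. E i p)"
  have "S X p \<in> tangent_space A p \<rightarrow> tangent_space A p"
    using S X pM unfolding is_S_map_def tensor_field_11_def by blast
  then have "S X p (E j p) \<in> tangent_space A p"
    by (rule funcset_mem) (rule C1_vector_fields_tangent[OF U(3) pU])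
  then have "?v \<in> tangent_space A p"
    unfolding S_derivation_def
    by (intro subspace_add[OF subspace_tangent_space] lie_bracket_tangent[OF X _ pM U(3) U(1) pU]) auto
  then have "(\<Sum>b\<in>?B. representation ?B ?v b *\<^sub>R b) = ?v"
    using basis[OF pU] by (intro sum_representation_eq) auto
  moreover have "representation ?B ?v b = 0" if "b \<in> ?B" for b
    using W X p that by (auto simp: components_vanish_on_def components_def)
  ultimately show ?thesis
    by simp
qed

text \<open>Only the values \<open>a\<close> and \<open>b\<close> of the coefficients at the point \<open>p\<close> enter. In the expansion of
  \<open>S\<^sub>X Y - S\<^sub>Y X + [X, Y]\<close> every derivative of \<open>X\<close> is taken in the direction \<open>Y\<close>, and occurs twice with
  opposite signs; likewise for \<open>Y\<close>. So the coefficients of \<open>X\<close> and \<open>Y\<close> never have to be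
  differentiated.\<close>

lemma torsion_frame:
  assumes S: "is_S_map M A S" and E: "basis_near M A Q E" and W: "components_vanish_on M A S Q E"
    and X: "X \<in> C1_vector_fields A (topspace M)" and Y: "Y \<in> C1_vector_fields A (topspace M)"
    and p: "p \<in> Q"
    and a: "X p = (\<Sum>i\<in>UNIV. a i *\<^sub>R E i p)" and b: "Y p = (\<Sum>j\<in>UNIV. b j *\<^sub>R E j p)"
  shows "torsion A S X Y p =
    - (\<Sum>i\<in>UNIV. \<Sum>j\<in>UNIV. (a i * b j) *\<^sub>R lie_bracket A (E i) (E j) p)"
proof -
  obtain U where U: "openin M U" "Q \<subseteq> U" "\<And>i. E i \<in> C1_vector_fields A U"
    using E unfolding basis_near_def by blast
  have pU: "p \<in> U" and pM: "p \<in> topspace M"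
    using p U openin_subset by blast+
  have SE: "S Z p (E j p) = - lie_bracket A Z (E j) p" if "Z \<in> C1_vector_fields A (topspace M)" for Z j
    using S_derivation_frame_eq_0[OF S E W that p, of j]
    by (simp add: S_derivation_def add_eq_0_iff)
  have Ssum: "S Z p (\<Sum>j\<in>UNIV. f j *\<^sub>R E j p) = - (\<Sum>j\<in>UNIV. f j *\<^sub>R lie_bracket A Z (E j) p)"
    if Z: "Z \<in> C1_vector_fields A (topspace M)" for Z f
  proof -
    have "tensor_field_11 M A (S Z)"
      using S Z by (simp add: is_S_map_def)
    then have "S Z p (\<Sum>j\<in>UNIV. f j *\<^sub>R E j p) = (\<Sum>j\<in>UNIV. f j *\<^sub>R S Z p (E j p))"
      by (rule tensor_field_11_sum[OF _ pM]) (rule C1_vector_fields_tangent[OF U(3) pU])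
    then show ?thesis
      by (simp add: SE[OF Z] sum_negf)
  qed
  \<comment> \<open>The brackets of \<open>X\<close> and \<open>Y\<close> in \<open>D\<^sub>X Y\<close> and in the torsion cancel; \<open>- [Y, X]\<close> from \<open>D\<^sub>Y X\<close> remains.\<close>
  have "torsion A S X Y p = S X p (Y p) - S Y p (X p) - lie_bracket A Y X p"
    by (simp add: torsion_def S_derivation_def)
  also have "\<dots> = - (\<Sum>j\<in>UNIV. b j *\<^sub>R lie_bracket A X (E j) p)
      + (\<Sum>i\<in>UNIV. a i *\<^sub>R lie_bracket A Y (E i) p) - lie_bracket A Y X p"
    by (simp add: b a Ssum[OF X] Ssum[OF Y])
  also have "\<dots> = - (\<Sum>i\<in>UNIV. \<Sum>j\<in>UNIV. (a i * b j) *\<^sub>R lie_bracket A (E i) (E j) p)"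
  proof (rule ext)
    fix c
    show "(- (\<Sum>j\<in>UNIV. b j *\<^sub>R lie_bracket A X (E j) p)
        + (\<Sum>i\<in>UNIV. a i *\<^sub>R lie_bracket A Y (E i) p) - lie_bracket A Y X p) c
      = (- (\<Sum>i\<in>UNIV. \<Sum>j\<in>UNIV. (a i * b j) *\<^sub>R lie_bracket A (E i) (E j) p)) c"
    proof (cases "c \<in> charts_at A p")
      case False
      then show ?thesis
        by (simp add: sum_fun_eval scaleR_fun_def lie_bracket_def)
    next
      case c: True
      let ?e = "\<lambda>j. E j p c"
      define DX where "DX = frechet_derivative (local_rep X c) (at (snd c p))"
      define DY where "DY = frechet_derivative (local_rep Y c) (at (snd c p))"
      define DE where "DE j = frechet_derivative (local_rep (E j) c) (at (snd c p))" for j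
      have lin: "linear DX" "linear DY" "linear (DE j)" for j
        unfolding DX_def DY_def DE_def
        by (rule linear_frechet_derivative, rule local_rep_differentiable[OF _ _ c],
            (rule X Y U(3) pM pU)+)+
      have Xc: "X p c = (\<Sum>i\<in>UNIV. a i *\<^sub>R ?e i)" and Yc: "Y p c = (\<Sum>j\<in>UNIV. b j *\<^sub>R ?e j)"
        by (simp_all add: a b sum_fun_eval scaleR_fun_def)
      have DXY: "DX (Y p c) = (\<Sum>j\<in>UNIV. b j *\<^sub>R DX (?e j))"
        and DYX: "DY (X p c) = (\<Sum>i\<in>UNIV. a i *\<^sub>R DY (?e i))"
        by (simp_all add: Xc Yc linear_sum lin linear_scale)
      have DEX: "b j *\<^sub>R DE j (X p c) = (\<Sum>i\<in>UNIV. (a i * b j) *\<^sub>R DE j (?e i))" for j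
        by (simp add: Xc linear_sum lin linear_scale scaleR_sum_right mult.commute)
      have DEY: "a i *\<^sub>R DE i (Y p c) = (\<Sum>j\<in>UNIV. (a i * b j) *\<^sub>R DE i (?e j))" for i
        by (simp add: Yc linear_sum lin linear_scale scaleR_sum_right)
      have "(\<Sum>j\<in>UNIV. b j *\<^sub>R lie_bracket A X (E j) p) c
          = (\<Sum>i\<in>UNIV. \<Sum>j\<in>UNIV. (a i * b j) *\<^sub>R DE j (?e i)) - DX (Y p c)"
        using c by (subst sum.swap)
          (simp add: sum_fun_eval scaleR_fun_def lie_bracket_def DX_def[symmetric] DE_def[symmetric]
            scaleR_diff_right sum_subtractf DXY DEX)
      moreover have "(\<Sum>i\<in>UNIV. a i *\<^sub>R lie_bracket A Y (E i) p) c
          = (\<Sum>i\<in>UNIV. \<Sum>j\<in>UNIV. (a i * b j) *\<^sub>R DE i (?e j)) - DY (X p c)"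
        using c by (simp add: sum_fun_eval scaleR_fun_def lie_bracket_def DY_def[symmetric] DE_def[symmetric]
            scaleR_diff_right sum_subtractf DYX DEY)
      moreover have "lie_bracket A Y X p c = DX (Y p c) - DY (X p c)"
        using c by (simp add: lie_bracket_def DX_def DY_def)
      moreover have "(\<Sum>i\<in>UNIV. \<Sum>j\<in>UNIV. (a i * b j) *\<^sub>R lie_bracket A (E i) (E j) p) c
          = (\<Sum>i\<in>UNIV. \<Sum>j\<in>UNIV. (a i * b j) *\<^sub>R DE j (?e i))
          - (\<Sum>i\<in>UNIV. \<Sum>j\<in>UNIV. (a i * b j) *\<^sub>R DE i (?e j))"
        using c by (simp add: sum_fun_eval scaleR_fun_def lie_bracket_def DE_def[symmetric]
            scaleR_diff_right sum_subtractf)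
      ultimately show ?thesis
        by simp
    qed
  qed
  finally show ?thesis .
qed

lemma tangent_vector_frame_coefficients:
  assumes E: "basis_near M A Q E" and p: "p \<in> Q" and v: "v \<in> tangent_space A p"
  shows "\<exists>a. v = (\<Sum>i\<in>UNIV. a i *\<^sub>R E i p)"
proof -
  have inj: "inj (\<lambda>i. E i p)" and span: "span (range (\<lambda>i. E i p)) = tangent_space A p"
    using E p unfolding basis_near_def by blast+
  obtain u where "v = (\<Sum>b\<in>range (\<lambda>i. E i p). u b *\<^sub>R b)"
    using v unfolding span[symmetric] span_finite[OF finite_imageI[OF finite]] by auto
  also have "\<dots> = (\<Sum>i\<in>UNIV. u (E i p) *\<^sub>R E i p)"
    by (simp add: sum.reindex[OF inj])
  finally show ?thesis
    by (rule exI[of _ "\<lambda>i. u (E i p)"])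
qed

section \<open>Holonomic frames and vanishing torsion\<close>

lemma torsion_free_of_holonomic:
  assumes S: "is_S_map M A S" and E: "basis_near M A Q E" and W: "components_vanish_on M A S Q E"
    and H: "holonomic_on A Q E"
  shows "torsion_free_on M A S Q"
  unfolding torsion_free_on_def
proof (intro ballI)
  fix X Y p
  assume X: "X \<in> C1_vector_fields A (topspace M)" and Y: "Y \<in> C1_vector_fields A (topspace M)"
    and p: "p \<in> Q"
  have pM: "p \<in> topspace M"
    using E p openin_subset unfolding basis_near_def by blast
  obtain a where a: "X p = (\<Sum>i\<in>UNIV. a i *\<^sub>R E i p)"
    by (rule exE[OF tangent_vector_frame_coefficients[OF E p C1_vector_fields_tangent[OF X pM]]])
  obtain b where b: "Y p = (\<Sum>j\<in>UNIV. b j *\<^sub>R E j p)"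
    by (rule exE[OF tangent_vector_frame_coefficients[OF E p C1_vector_fields_tangent[OF Y pM]]])
  show "torsion A S X Y p = 0"
    using torsion_frame[OF S E W X Y p a b] H p by (simp add: holonomic_on_def)
qed

text \<open>With global extensions \<open>X\<close> of \<open>E\<^sub>k p\<close> and \<open>Y\<close> of \<open>E\<^sub>l p\<close>, the coefficients in \<open>torsion_frame\<close> are
  Kronecker deltas and the sum collapses to \<open>- [E\<^sub>k, E\<^sub>l]\<close>.\<close>

lemma holonomic_of_torsion_free:
  assumes S: "is_S_map M A S" and E: "basis_near M A Q E" and W: "components_vanish_on M A S Q E"
    and T: "torsion_free_on M A S Q"
  shows "holonomic_on A Q E"
  unfolding holonomic_on_def
proof (intro allI ballI)
  fix k l p assume p: "p \<in> Q"
  obtain U where U: "openin M U" "Q \<subseteq> U" "\<And>i. E i \<in> C1_vector_fields A U"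
    using E unfolding basis_near_def by blast
  have pU: "p \<in> U" and pM: "p \<in> topspace M"
    using p U openin_subset by blast+
  note extend = bexE[OF tangent_vector_extends[OF pM C1_vector_fields_tangent[OF U(3) pU]]]
  obtain X where X: "X \<in> C1_vector_fields A (topspace M)" "X p = E k p"
    by (rule extend)
  obtain Y where Y: "Y \<in> C1_vector_fields A (topspace M)" "Y p = E l p"
    by (rule extend)
  have delta: "(\<Sum>i\<in>UNIV. (if i = j then 1 else 0) *\<^sub>R f i) = f j" for j and f :: "'n \<Rightarrow> ('m, 'n) tangent_vector"
    by (simp add: if_distrib[of "\<lambda>x. x *\<^sub>R _"] cong: if_cong)
  have "torsion A S X Y p = - (\<Sum>i\<in>UNIV. \<Sum>j\<in>UNIV.
      ((if i = k then 1 else 0) * (if j = l then 1 else 0)) *\<^sub>R lie_bracket A (E i) (E j) p)"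
    by (rule torsion_frame[OF S E W X(1) Y(1) p]) (simp_all only: delta X(2) Y(2))
  also have "\<dots> = - lie_bracket A (E k) (E l) p"
    by (simp only: scaleR_scaleR[symmetric] scaleR_sum_right[symmetric] delta)
  finally show "lie_bracket A (E k) (E l) p = 0"
    using T X(1) Y(1) p by (simp add: torsion_free_on_def)
qed

end

theorem proposition3:
  fixes M :: "'m topology" and A :: "('m, 'n::finite) chart set"
    and J :: "real set" and \<gamma> :: "real \<Rightarrow> 'm" and S :: "('m, 'n) S_map"
  assumes "differentiable_manifold M A"
    and "is_interval J"
    and "continuous_map (top_of_set J) M \<gamma>"
    and "is_S_map M A S"
  shows "((\<exists>E. basis_near M A (\<gamma> ` J) E \<and> holonomic_on A (\<gamma> ` J) E \<and>
              components_vanish_on M A S (\<gamma> ` J) E)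
            \<longrightarrow> torsion_free_on M A S (\<gamma> ` J)) \<and>
         (torsion_free_on M A S (\<gamma> ` J) \<and>
            (\<exists>E. basis_near M A (\<gamma> ` J) E \<and> components_vanish_on M A S (\<gamma> ` J) E)
            \<longrightarrow> (\<forall>E. basis_near M A (\<gamma> ` J) E \<and> components_vanish_on M A S (\<gamma> ` J) E
                    \<longrightarrow> holonomic_on A (\<gamma> ` J) E))"
  using torsion_free_of_holonomic[OF assms(1,4)] holonomic_of_torsion_free[OF assms(1,4)] by blast

end
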